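(* For every $0<\varepsilon<1$ there are $\delta,k_0>0$ such that the following holds. Let $k\geq k_0$ and let $\Phi$ be a $k$-vertex graph invariant such that \[1\leq|\operatorname{supp}(\Phi\cdot\Phi_{\mathsf{even}})|\leq(\sqrt{2}-\varepsilon)^{\binom{k}{2}}.\] Then there is a $k$-vertex graph $H$ such that $\widehat{\Phi}(H)\neq0$ and $|E(H)|\geq\delta\cdot\binom{k}{2}$.
   Context: All graphs are finite, simple and undirected. A $k$-vertex graph invariant is an isomorphism-invariant map $\Phi$ from graphs to $\mathbb{Q}$ with $\Phi(G)=0$ whenever $|V(G)|\neq k$. $\Phi_{\mathsf{even}}(G)=1$ if every vertex of $G$ has even degree and $0$ otherwise; $(\Phi\cdot\Phi_{\mathsf{even}})(G)=\Phi(G)\Phi_{\mathsf{even}}(G)$. For a $k$-vertex invariant $\Psi$, $\operatorname{supp}(\Psi)$ is the set of graphs with vertex set exactly $\{1,\dots,k\}$ on which $\Psi$ is nonzero. The alternating enumerator is $\widehat{\Phi}(H)=(-1)^{|E(H)|}\sum_{S\subseteq E(H)}(-1)^{|S|}\Phi(H[S])$, where $H[S]=(V(H),S)$. *)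

theory Defs
  imports Complex_Main
begin

type_synonym 'a sgraph = "'a set \<times> 'a set set"

abbreviation verts :: "'a sgraph \<Rightarrow> 'a set" where
  "verts G \<equiv> fst G"

abbreviation edges :: "'a sgraph \<Rightarrow> 'a set set" where
  "edges G \<equiv> snd G"

definition simple_graph :: "'a sgraph \<Rightarrow> bool" where
  "simple_graph G \<longleftrightarrow> finite (verts G) \<and> (\<forall>e\<in>edges G. e \<subseteq> verts G \<and> card e = 2)"

definition graph_iso :: "'a sgraph \<Rightarrow> 'b sgraph \<Rightarrow> bool" where
  "graph_iso G H \<longleftrightarrow>
     (\<exists>f. bij_betw f (verts G) (verts H) \<and>
          (\<forall>u\<in>verts G. \<forall>v\<in>verts G. {u, v} \<in> edges G \<longleftrightarrow> {f u, f v} \<in> edges H))"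

definition degree :: "'a sgraph \<Rightarrow> 'a \<Rightarrow> nat" where
  "degree G v = card {e \<in> edges G. v \<in> e}"

(* Graphs have natural numbers as vertices: every finite graph is isomorphic to such a graph, so an
   isomorphism-invariant map is determined by its values on these. The values of the function on
   pairs that are not simple graphs are irrelevant and left unconstrained. *)
definition graph_invariant :: "nat \<Rightarrow> (nat sgraph \<Rightarrow> rat) \<Rightarrow> bool" where
  "graph_invariant k \<Phi> \<longleftrightarrow>
     (\<forall>G H. simple_graph G \<longrightarrow> simple_graph H \<longrightarrow> graph_iso G H \<longrightarrow> \<Phi> G = \<Phi> H) \<and>
     (\<forall>G. simple_graph G \<longrightarrow> card (verts G) \<noteq> k \<longrightarrow> \<Phi> G = 0)"

definition Phi_even :: "'a sgraph \<Rightarrow> rat" where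
  "Phi_even G = (if \<forall>v\<in>verts G. even (degree G v) then 1 else 0)"

definition supp :: "nat \<Rightarrow> (nat sgraph \<Rightarrow> rat) \<Rightarrow> nat sgraph set" where
  "supp k \<Psi> = {G. simple_graph G \<and> verts G = {1..k} \<and> \<Psi> G \<noteq> 0}"

definition alt_enum :: "('a sgraph \<Rightarrow> rat) \<Rightarrow> 'a sgraph \<Rightarrow> rat" where
  "alt_enum \<Phi> H =
     (-1) ^ card (edges H) * (\<Sum>S\<in>Pow (edges H). (-1) ^ card S * \<Phi> (verts H, S))"

end

theory Submission
  imports Defs
begin

text \<open>
  Identify graphs on \<open>{1..k}\<close> with subsets of the set \<open>U\<close> of all \<open>n = k choose 2\<close> edges and
  expand functions of such subsets in Walsh characters. If \<open>alt_enum \<Phi>\<close> vanishes on all graphs with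
  at least \<open>\<delta> n\<close> edges, then \<open>\<Phi>\<close> is a combination of characters of sets of size
  less than \<open>\<delta> n\<close>; for small \<open>\<delta>\<close> these number at most \<open>2 ^ (n/4)\<close>. The indicator of even graphs is the
  average of the \<open>2 ^ k\<close> characters of cuts. So the product is a combination of at most
  \<open>2 ^ (n/2)\<close> characters once \<open>k\<close> is large, and by the uncertainty principle for Walsh expansions it
  is either identically zero or nonzero at no fewer than \<open>2 ^ (n/2)\<close> points.
\<close>

section \<open>Walsh characters and their orthogonality\<close>

text \<open>This is the character with index \<open>S\<close> at the point \<open>T\<close>. For
  finite sets it equals (-1) to the power \<open>card (S \<inter> T)\<close>, hence is symmetric in
  \<open>S\<close> and \<open>T\<close>.\<close>

definition walsh :: "'b set \<Rightarrow> 'b set \<Rightarrow> 'a::linordered_field" where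
  "walsh S T = (\<Prod>e\<in>T. if e \<in> S then -1 else 1)"

lemma walsh_mult: "walsh S T * walsh S' T = walsh (sym_diff S S') T"
  unfolding walsh_def prod.distrib[symmetric] by (rule prod.cong) auto

lemma abs_walsh [simp]: "\<bar>walsh S T\<bar> = 1"
proof -
  have "\<bar>walsh S T\<bar> = (\<Prod>e\<in>T. 1)"
    unfolding walsh_def abs_prod by (rule prod.cong) auto
  then show ?thesis by simp
qed

lemma walsh_commute:
  assumes "finite S" "finite T"
  shows "(walsh S T :: 'a::linordered_field) = walsh T S"
proof -
  have "walsh S T = (\<Prod>e\<in>S \<inter> T. - 1 :: 'a)" if "finite T" for S T :: "'b set"
    unfolding walsh_def using that by (subst Int_commute, subst prod.inter_restrict) auto
  with assms show ?thesis by (metis Int_commute)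
qed

lemma prod_one_plus:
  fixes g :: "'b \<Rightarrow> 'a::comm_semiring_1"
  assumes "finite U"
  shows "(\<Sum>T\<in>Pow U. \<Prod>e\<in>T. g e) = (\<Prod>e\<in>U. g e + 1)"
  using prod_add[OF assms, of g "\<lambda>_. 1"] by simp

text \<open>The sum factors over the elements of \<open>U\<close>, and every element of
  \<open>S\<close> contributes the factor -1 + 1 = 0.\<close>

lemma sum_walsh:
  assumes "finite U" "S \<subseteq> U"
  shows "(\<Sum>T\<in>Pow U. walsh S T :: 'a::linordered_field) = (if S = {} then 2 ^ card U else 0)"
proof -
  have "(\<Sum>T\<in>Pow U. walsh S T) = (\<Prod>e\<in>U. (if e \<in> S then -1 else 1) + (1::'a))"
    unfolding walsh_def by (rule prod_one_plus[OF assms(1)])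
  also have "\<dots> = (if S = {} then 2 ^ card U else 0)"
    using assms by auto
  finally show ?thesis .
qed

lemma walsh_orthogonal:
  assumes "finite U" "S \<subseteq> U" "S' \<subseteq> U"
  shows "(\<Sum>T\<in>Pow U. walsh S' T * walsh S T) = (if S' = S then 2 ^ card U else 0)"
proof -
  have "sym_diff S' S \<subseteq> U" "sym_diff S' S = {} \<longleftrightarrow> S' = S" using assms by auto
  then show ?thesis unfolding walsh_mult using sum_walsh[OF assms(1)] by metis
qed

section \<open>Uncertainty principle\<close>

text \<open>Let \<open>M\<close> be the maximum of the absolute value of \<open>f\<close>. By
  orthogonality each coefficient is at most \<open>M\<close> times the size of the support, divided
  by \<open>2 ^ card U\<close>. Conversely, \<open>M\<close> is at most the sum of the absolute
  values of the coefficients. Chaining both bounds and cancelling \<open>M\<close> gives the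
  claim.\<close>

lemma uncertainty:
  fixes f :: "'b set \<Rightarrow> 'a::linordered_field"
  assumes U: "finite U" and A: "A \<subseteq> Pow U"
    and f: "\<And>T. T \<subseteq> U \<Longrightarrow> f T = (\<Sum>S\<in>A. c S * walsh S T)"
    and nz: "T\<^sub>1 \<subseteq> U" "f T\<^sub>1 \<noteq> 0"
  shows "2 ^ card U \<le> card A * card {T \<in> Pow U. f T \<noteq> 0}"
proof -
  let ?Z = "{T \<in> Pow U. f T \<noteq> 0}"
  have finA: "finite A" using A U by (meson finite_Pow_iff finite_subset)
  obtain T\<^sub>0 where T0: "T\<^sub>0 \<subseteq> U" "\<And>T. T \<subseteq> U \<Longrightarrow> \<bar>f T\<bar> \<le> \<bar>f T\<^sub>0\<bar>"
  proof -
    let ?F = "(\<lambda>T. \<bar>f T\<bar>) ` Pow U"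
    have "finite ?F" "?F \<noteq> {}" using U by auto
    then have "Max ?F \<in> ?F" "\<And>T. T \<subseteq> U \<Longrightarrow> \<bar>f T\<bar> \<le> Max ?F"
      by (auto intro: Max_in Max_ge)
    with that show ?thesis by auto
  qed
  define M where "M = \<bar>f T\<^sub>0\<bar>"
  have M: "M > 0" using T0(2)[OF nz(1)] nz(2) unfolding M_def by auto
  \<comment> \<open>Fourier inversion: pairing \<open>f\<close> with the character of
    \<open>S\<close> isolates \<open>c S\<close>.\<close>
  have coeff: "2 ^ card U * \<bar>c S\<bar> \<le> of_nat (card ?Z) * M" if S: "S \<in> A" for S
  proof -
    have "(\<Sum>T\<in>Pow U. f T * walsh S T) = (\<Sum>T\<in>Pow U. \<Sum>S'\<in>A. c S' * (walsh S' T * walsh S T))"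
      by (rule sum.cong) (auto simp: f sum_distrib_right mult.assoc)
    also have "\<dots> = (\<Sum>S'\<in>A. c S' * (\<Sum>T\<in>Pow U. walsh S' T * walsh S T))"
      by (subst sum.swap) (simp add: sum_distrib_left)
    also have "\<dots> = (\<Sum>S'\<in>A. if S' = S then c S * 2 ^ card U else 0)"
    proof (rule sum.cong)
      fix S' assume "S' \<in> A"
      then have "S \<subseteq> U" "S' \<subseteq> U" using A S by auto
      then show "c S' * (\<Sum>T\<in>Pow U. walsh S' T * walsh S T) = (if S' = S then c S * 2 ^ card U else 0)"
        by (simp add: walsh_orthogonal[OF U])
    qed simp
    also have "\<dots> = c S * 2 ^ card U" using S finA by simp
    finally have "\<bar>c S * 2 ^ card U\<bar> = \<bar>\<Sum>T\<in>Pow U. f T * walsh S T\<bar>" by simp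
    also have "\<dots> \<le> (\<Sum>T\<in>Pow U. \<bar>f T * walsh S T\<bar>)" by (rule sum_abs)
    also have "\<dots> = (\<Sum>T\<in>?Z. \<bar>f T\<bar>)"
      by (rule sum.mono_neutral_cong_right) (use U in \<open>auto simp: abs_mult\<close>)
    also have "\<dots> \<le> of_nat (card ?Z) * M"
      by (rule sum_bounded_above) (auto simp: M_def T0)
    finally show ?thesis by (simp add: abs_mult mult.commute)
  qed
  have "M \<le> (\<Sum>S\<in>A. \<bar>c S * walsh S T\<^sub>0\<bar>)"
    unfolding M_def f[OF T0(1)] by (rule sum_abs)
  then have "2 ^ card U * M \<le> 2 ^ card U * (\<Sum>S\<in>A. \<bar>c S\<bar>)"
    by (simp add: abs_mult)
  also have "\<dots> = (\<Sum>S\<in>A. 2 ^ card U * \<bar>c S\<bar>)"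
    by (simp add: sum_distrib_left)
  also have "\<dots> \<le> of_nat (card A) * (of_nat (card ?Z) * M)"
    by (rule sum_bounded_above) (rule coeff)
  finally have "2 ^ card U * M \<le> of_nat (card A * card ?Z) * M" by (simp add: mult.assoc)
  then have "(2 ^ card U :: 'a) \<le> of_nat (card A * card ?Z)"
    using M by (simp only: mult_le_cancel_right_pos)
  then have "(of_nat (2 ^ card U) :: 'a) \<le> of_nat (card A * card ?Z)" by simp
  then show ?thesis by (simp only: of_nat_le_iff)
qed

text \<open>Characters may repeat in the family: merging the coefficients of equal ones only lowers
  their number. This spares a proof that the symmetric differences arising in a product of two
  expansions are distinct.\<close>

lemma uncertainty_family:
  fixes f :: "'b set \<Rightarrow> 'a::linordered_field"
  assumes U: "finite U" and I: "finite I" and s: "\<And>i. i \<in> I \<Longrightarrow> s i \<subseteq> U"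
    and f: "\<And>T. T \<subseteq> U \<Longrightarrow> f T = (\<Sum>i\<in>I. c i * walsh (s i) T)"
    and nz: "T\<^sub>1 \<subseteq> U" "f T\<^sub>1 \<noteq> 0"
  shows "2 ^ card U \<le> card I * card {T \<in> Pow U. f T \<noteq> 0}"
proof -
  have "f T = (\<Sum>S\<in>s ` I. (\<Sum>i\<in>{i \<in> I. s i = S}. c i) * walsh S T)" if "T \<subseteq> U" for T
    unfolding f[OF that] sum.image_gen[OF I, of _ s]
    by (rule sum.cong) (auto simp: sum_distrib_right intro!: sum.cong)
  from uncertainty[OF U _ this nz] s
  have "2 ^ card U \<le> card (s ` I) * card {T \<in> Pow U. f T \<noteq> 0}" by blast
  also have "\<dots> \<le> card I * card {T \<in> Pow U. f T \<noteq> 0}"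
    by (intro mult_right_mono card_image_le I) simp
  finally show ?thesis .
qed

section \<open>Walsh expansions of invariants and of the indicator of even graphs\<close>

lemma indicator_subset_walsh:
  assumes "finite S" "finite T"
  shows "(if S \<subseteq> T then 1 else 0) = (\<Sum>R\<in>Pow S. (-1) ^ card R * walsh R T) / (2 ^ card S :: 'a::linordered_field)"
proof -
  have "(\<Sum>R\<in>Pow S. (-1) ^ card R * walsh R T) = (\<Sum>R\<in>Pow S. \<Prod>e\<in>R. if e \<in> T then 1 else - 1 :: 'a)"
  proof (rule sum.cong)
    fix R assume "R \<in> Pow S"
    \<comment> \<open>Symmetry turns the product over \<open>T\<close> into one over
      \<open>R\<close>, so that the sign can be absorbed factor by factor.\<close>
    then have "walsh R T = (walsh T R :: 'a)" using assms by (auto intro: walsh_commute finite_subset)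
    then show "(-1) ^ card R * walsh R T = (\<Prod>e\<in>R. if e \<in> T then 1 else - 1 :: 'a)"
      by (simp add: walsh_def flip: prod_constant prod.distrib) (rule prod.cong, auto)
  qed simp
  also have "\<dots> = (\<Prod>e\<in>S. (if e \<in> T then 1 else - 1) + 1)"
    by (rule prod_one_plus[OF assms(1)])
  also have "\<dots> = (if S \<subseteq> T then 2 ^ card S else 0)"
  proof (cases "S \<subseteq> T")
    case True
    then have "(\<Prod>e\<in>S. (if e \<in> T then 1 else - 1) + 1) = (\<Prod>e\<in>S. 2 :: 'a)"
      by (intro prod.cong) auto
    with True show ?thesis by simp
  qed (use assms in auto)
  finally show ?thesis by simp
qed

text \<open>The indicator of \<open>S \<subseteq> T\<close> only involves characters of subsets of
  \<open>S\<close>, and these stay in \<open>B\<close> because \<open>B\<close> is closed downwards.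
  Exchanging the sums collects the coefficients.\<close>

lemma low_degree_walsh:
  fixes h :: "'b set \<Rightarrow> 'a::linordered_field"
  assumes U: "finite U" and B: "B \<subseteq> Pow U" "\<And>S R. S \<in> B \<Longrightarrow> R \<subseteq> S \<Longrightarrow> R \<in> B"
    and h: "\<And>S. S \<subseteq> U \<Longrightarrow> S \<notin> B \<Longrightarrow> h S = 0"
  shows "\<exists>c. \<forall>T\<subseteq>U. (\<Sum>S\<in>Pow T. h S) = (\<Sum>R\<in>B. c R * walsh R T)"
proof (intro exI allI impI)
  fix T assume T: "T \<subseteq> U"
  have fin: "finite B" "finite T" "\<And>S. S \<in> B \<Longrightarrow> finite S"
    using U B(1) T by (meson finite_Pow_iff finite_subset PowD subsetD)+
  have "(\<Sum>S\<in>Pow T. h S) = (\<Sum>S\<in>B. h S * (if S \<subseteq> T then 1 else 0))"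
    by (rule sum.mono_neutral_cong) (use fin T h B(1) in auto)
  also have "\<dots> = (\<Sum>S\<in>B. \<Sum>R\<in>{R \<in> B. R \<subseteq> S}. h S / 2 ^ card S * ((-1) ^ card R * walsh R T))"
  proof (rule sum.cong)
    fix S assume S: "S \<in> B"
    then have "{R \<in> B. R \<subseteq> S} = Pow S" using B(2) by auto
    then show "h S * (if S \<subseteq> T then 1 else 0)
        = (\<Sum>R\<in>{R \<in> B. R \<subseteq> S}. h S / 2 ^ card S * ((-1) ^ card R * walsh R T))"
      unfolding indicator_subset_walsh[OF fin(3)[OF S] fin(2)]
      by (simp only: sum_distrib_left[symmetric]) simp
  qed simp
  also have "\<dots> = (\<Sum>R\<in>B. \<Sum>S\<in>{S \<in> B. R \<subseteq> S}. h S / 2 ^ card S * ((-1) ^ card R * walsh R T))"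
    by (rule sum.swap_restrict) (rule fin)+
  also have "\<dots> = (\<Sum>R\<in>B. (\<Sum>S\<in>{S \<in> B. R \<subseteq> S}. h S / 2 ^ card S * (-1) ^ card R) * walsh R T)"
    by (simp add: sum_distrib_right mult.assoc)
  finally show "(\<Sum>S\<in>Pow T. h S)
    = (\<Sum>R\<in>B. (\<Sum>S\<in>{S \<in> B. R \<subseteq> S}. h S / 2 ^ card S * (-1) ^ card R) * walsh R T)" .
qed

text \<open>Moebius inversion on the subset lattice recovers the invariant from its alternating
  enumerator.\<close>

lemma sum_alt_enum:
  assumes "finite T"
  shows "(\<Sum>S\<in>Pow T. alt_enum \<Phi> (V, S)) = \<Phi> (V, T)"
proof -
  define g where "g S = (\<Sum>R\<in>Pow S. (-1) ^ card R * \<Phi> (V, R))" for S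
  have "\<Phi> (V, T) = (\<Sum>S\<in>Pow T. (-1) ^ card S * g S)"
    by (rule inclusion_exclusion_symmetric[OF _ assms]) (rule g_def)
  then show ?thesis by (simp add: alt_enum_def g_def)
qed

text \<open>The character of the edges at \<open>v\<close> takes the value (-1) to the degree of
  \<open>v\<close>, and multiplying these over \<open>W\<close> gives the character of the cut of
  \<open>W\<close>. The sum over all \<open>W\<close> thus factors over the vertices, with factor 2
  at even and 0 at odd degree.\<close>

lemma Phi_even_walsh:
  assumes "finite V" "finite T" "T \<subseteq> U"
  shows "Phi_even (V, T) = (\<Sum>W\<in>Pow V. 1 / 2 ^ card V * walsh {e \<in> U. odd (card (W \<inter> e))} T)"
proof -
  have star: "walsh {e. v \<in> e} T = (-1 :: rat) ^ degree (V, T) v" for v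
    unfolding walsh_def degree_def using assms(2)
    by (subst prod.inter_filter[symmetric]) auto
  have cut: "walsh {e \<in> U. odd (card (W \<inter> e))} T = (\<Prod>v\<in>W. walsh {e. v \<in> e} T :: rat)"
    if "W \<subseteq> V" for W
  proof -
    have W: "finite W" using that assms(1) finite_subset by blast
    have "(\<Prod>v\<in>W. walsh {e. v \<in> e} T) = (\<Prod>e\<in>T. \<Prod>v\<in>W. if v \<in> e then -1 else (1::rat))"
      unfolding walsh_def by (subst prod.swap) simp
    also have "\<dots> = (\<Prod>e\<in>T. (-1) ^ card (W \<inter> e))"
      by (rule prod.cong) (use prod.inter_restrict[OF W, of "\<lambda>_. -1 :: rat"] in simp_all)
    also have "\<dots> = walsh {e \<in> U. odd (card (W \<inter> e))} T"
      unfolding walsh_def by (rule prod.cong) (use assms(3) in auto)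
    finally show ?thesis by simp
  qed
  have "(\<Sum>W\<in>Pow V. walsh {e \<in> U. odd (card (W \<inter> e))} T) =
      (\<Sum>W\<in>Pow V. \<Prod>v\<in>W. (-1 :: rat) ^ degree (V, T) v)"
    by (rule sum.cong) (auto simp: cut star)
  also have "\<dots> = (\<Prod>v\<in>V. (-1) ^ degree (V, T) v + 1)"
    by (rule prod_one_plus[OF assms(1)])
  also have "\<dots> = 2 ^ card V * Phi_even (V, T)"
  proof (cases "\<forall>v\<in>V. even (degree (V, T) v)")
    case True
    then have "(\<Prod>v\<in>V. (-1) ^ degree (V, T) v + 1) = (\<Prod>v\<in>V. 2 :: rat)"
      by (intro prod.cong) auto
    with True show ?thesis by (simp add: Phi_even_def)
  next
    case False
    then obtain v where "v \<in> V" "odd (degree (V, T) v)" by blast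
    with assms(1) have "(\<Prod>v\<in>V. (-1 :: rat) ^ degree (V, T) v + 1) = 0"
      by (intro prod_zero bexI[of _ v]) auto
    with False show ?thesis by (auto simp: Phi_even_def)
  qed
  finally show ?thesis by (simp add: sum_divide_distrib[symmetric])
qed

section \<open>Counting small sets and bounding the support\<close>

text \<open>Give each subset the weight \<open>(1/10) ^ card S\<close>. The total weight is
  \<open>(11/10) ^ n\<close>, while each counted set weighs at least
  \<open>(1/10) ^ d\<close>.\<close>

lemma card_small_subsets:
  assumes U: "finite U"
  shows "card {S \<in> Pow U. 100 * card S < card U} ^ 4 \<le> 2 ^ card U"
proof -
  let ?B = "{S \<in> Pow U. 100 * card S < card U}"
  define n d where "n = card U" and "d = card U div 100"
  have "real (card ?B) * (1/10) ^ d = (\<Sum>S\<in>?B. (1/10) ^ d)" by simp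
  also have "\<dots> \<le> (\<Sum>S\<in>?B. (1/10) ^ card S)"
    by (intro sum_mono power_decreasing) (auto simp: d_def)
  also have "\<dots> \<le> (\<Sum>S\<in>Pow U. \<Prod>e\<in>S. 1/10)"
    unfolding prod_constant by (rule sum_mono2) (use U in auto)
  also have "\<dots> = (11/10) ^ n"
    unfolding prod_one_plus[OF U] by (simp add: n_def)
  finally have "real (card ?B) \<le> (11/10) ^ n * 10 ^ d"
    by (simp add: power_one_over field_simps)
  \<comment> \<open>The 100th power removes the rounding in \<open>d\<close>, since
    \<open>100 * d\<close> is at most \<open>n\<close>.\<close>
  then have "real (card ?B) ^ 100 \<le> ((11/10) ^ n * 10 ^ d) ^ 100"
    by (intro power_mono) auto
  also have "\<dots> = ((11/10) ^ 100) ^ n * 10 ^ (100 * d)"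
    by (simp only: power_mult_distrib power_mult[symmetric] mult.commute)
  also have "\<dots> \<le> ((11/10) ^ 100) ^ n * 10 ^ n"
    by (intro mult_left_mono power_increasing) (auto simp: d_def n_def)
  also have "\<dots> = ((11/10) ^ 100 * 10) ^ n"
    by (simp only: power_mult_distrib)
  \<comment> \<open>The base on the left is below 140000. The exponent 25 is 100/4, which leaves the
    fourth power of the count.\<close>
  also have "\<dots> \<le> (2 ^ 25) ^ n"
    by (intro power_mono) (simp_all add: power_divide)
  finally have "(real (card ?B) ^ 4) ^ 25 \<le> (2 ^ n) ^ 25"
    by (simp only: power_mult[symmetric] mult.commute) simp
  then have "real (card ?B) ^ 4 \<le> 2 ^ n"
    by (subst (asm) power_mono_iff) auto
  then have "real (card ?B ^ 4) \<le> real (2 ^ n)" by simp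
  then show ?thesis unfolding n_def by (simp only: of_nat_le_iff)
qed

lemma card_even_supp_ge:
  fixes \<Phi> :: "'b sgraph \<Rightarrow> rat"
  assumes V: "finite V" and U: "finite U"
    and h: "\<And>S. S \<subseteq> U \<Longrightarrow> 100 * card S \<ge> card U \<Longrightarrow> alt_enum \<Phi> (V, S) = 0"
    and large: "4 * card V \<le> card U"
    and nz: "T\<^sub>1 \<subseteq> U" "\<Phi> (V, T\<^sub>1) * Phi_even (V, T\<^sub>1) \<noteq> 0"
  shows "2 ^ card U \<le> card {T \<in> Pow U. \<Phi> (V, T) * Phi_even (V, T) \<noteq> 0} ^ 2"
proof -
  define n where "n = card U"
  define B where "B = {S \<in> Pow U. 100 * card S < card U}"
  define X where "X W = {e \<in> U. odd (card (W \<inter> e))}" for W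
  let ?Z = "{T \<in> Pow U. \<Phi> (V, T) * Phi_even (V, T) \<noteq> 0}"
  have B: "B \<subseteq> Pow U" "finite B" using U by (auto simp: B_def)
  have Bdown: "R \<in> B" if "S \<in> B" "R \<subseteq> S" for S R
  proof -
    have "card R \<le> card S" using that U by (intro card_mono) (auto simp: B_def intro: finite_subset)
    with that show ?thesis by (auto simp: B_def)
  qed
  have "\<exists>c. \<forall>T\<subseteq>U. (\<Sum>S\<in>Pow T. alt_enum \<Phi> (V, S)) = (\<Sum>R\<in>B. c R * walsh R T)"
    by (rule low_degree_walsh[OF U B(1) Bdown]) (auto simp: B_def intro: h)
  then obtain c where c: "\<And>T. T \<subseteq> U \<Longrightarrow> (\<Sum>S\<in>Pow T. alt_enum \<Phi> (V, S)) = (\<Sum>R\<in>B. c R * walsh R T)"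
    by blast
  have expand: "\<Phi> (V, T) * Phi_even (V, T) =
      (\<Sum>i\<in>B \<times> Pow V. (c (fst i) / 2 ^ card V) * walsh (sym_diff (fst i) (X (snd i))) T)"
    if T: "T \<subseteq> U" for T
  proof -
    have T': "finite T" using T U finite_subset by blast
    have "\<Phi> (V, T) * Phi_even (V, T) =
        (\<Sum>R\<in>B. c R * walsh R T) * (\<Sum>W\<in>Pow V. 1 / 2 ^ card V * walsh (X W) T)"
      unfolding Phi_even_walsh[OF V T' T] c[OF T, symmetric] sum_alt_enum[OF T'] X_def ..
    also have "\<dots> = (\<Sum>R\<in>B. \<Sum>W\<in>Pow V. (c R / 2 ^ card V) * walsh (sym_diff R (X W)) T)"
      unfolding sum_product walsh_mult[symmetric] by (simp add: mult_ac)
    finally show ?thesis by (simp add: sum.cartesian_product case_prod_unfold)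
  qed
  have "2 ^ n \<le> card (B \<times> Pow V) * card ?Z"
    unfolding n_def
    by (rule uncertainty_family[OF U _ _ expand nz]) (use B V in \<open>auto 0 4 simp: X_def\<close>)
  then have unc: "2 ^ n \<le> card B * 2 ^ card V * card ?Z"
    using V by (simp add: card_cartesian_product card_Pow)
  \<comment> \<open>Fourth powers express the bound \<open>2 ^ (n/2)\<close> on the number of
    characters without fractional exponents.\<close>
  have "((card B * 2 ^ card V)\<^sup>2)\<^sup>2 = card B ^ 4 * 2 ^ (4 * card V)"
    by (simp add: power_mult_distrib power_mult[symmetric] mult.commute)
  also have "\<dots> \<le> 2 ^ n * 2 ^ n"
    using card_small_subsets[OF U] large unfolding B_def n_def
    by (intro mult_mono power_increasing) auto
  also have "\<dots> = (2 ^ n)\<^sup>2" by (simp add: power2_eq_square)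
  finally have N: "(card B * 2 ^ card V)\<^sup>2 \<le> 2 ^ n" by (simp only: power2_nat_le_eq_le)
  have "(2 ^ n)\<^sup>2 \<le> (card B * 2 ^ card V * card ?Z)\<^sup>2" using unc by (rule power_mono) simp
  also have "\<dots> = (card B * 2 ^ card V)\<^sup>2 * (card ?Z)\<^sup>2" by (rule power_mult_distrib)
  also have "\<dots> \<le> 2 ^ n * (card ?Z)\<^sup>2" using N by (rule mult_right_mono) simp
  finally show ?thesis by (simp add: power2_eq_square n_def)
qed

theorem theorem6p6:
  fixes \<epsilon> :: real
  assumes "0 < \<epsilon>" and "\<epsilon> < 1"
  shows "\<exists>\<delta>::real. \<exists>k\<^sub>0::nat. \<delta> > 0 \<and> k\<^sub>0 > 0 \<and>
    (\<forall>k\<ge>k\<^sub>0. \<forall>\<Phi> :: nat sgraph \<Rightarrow> rat.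
       graph_invariant k \<Phi> \<longrightarrow>
       1 \<le> card (supp k (\<lambda>G. \<Phi> G * Phi_even G)) \<longrightarrow>
       real (card (supp k (\<lambda>G. \<Phi> G * Phi_even G))) \<le> (sqrt 2 - \<epsilon>) ^ (k choose 2) \<longrightarrow>
       (\<exists>H. simple_graph H \<and> card (verts H) = k \<and> alt_enum \<Phi> H \<noteq> 0 \<and>
            real (card (edges H)) \<ge> \<delta> * real (k choose 2)))"
\<comment> \<open>The value 1/100 is the threshold of \<open>card_small_subsets\<close>; from
  \<open>k = 9\<close> on, \<open>k choose 2\<close> is at least \<open>4 * k\<close>. Neither
  depends on \<open>\<epsilon>\<close>.\<close>
proof (rule exI[of _ "1/100"], rule exI[of _ 9], intro conjI allI impI)
  fix k :: nat and \<Phi> :: "nat sgraph \<Rightarrow> rat"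
  let ?\<Psi> = "\<lambda>G. \<Phi> G * Phi_even G"
  assume k: "9 \<le> k" and ne: "1 \<le> card (supp k ?\<Psi>)"
    and le: "real (card (supp k ?\<Psi>)) \<le> (sqrt 2 - \<epsilon>) ^ (k choose 2)"
  define n where "n = k choose 2"
  define U where "U = {e. e \<subseteq> {1..k} \<and> card e = 2}"
  let ?Z = "{T \<in> Pow U. ?\<Psi> ({1..k}, T) \<noteq> 0}"
  have U: "finite U" unfolding U_def by simp
  have cardU: "card U = n" unfolding U_def n_def by (simp add: n_subsets)
  have simple: "simple_graph ({1..k}, T) \<longleftrightarrow> T \<subseteq> U" for T
    by (auto simp: simple_graph_def U_def)
  have mem: "G \<in> supp k \<Psi> \<longleftrightarrow> G \<in> Pair {1..k} ` {T \<in> Pow U. \<Psi> ({1..k}, T) \<noteq> 0}" for G \<Psi>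
    using simple by (cases G) (auto simp: supp_def)
  have "supp k ?\<Psi> = Pair {1..k} ` ?Z"
    by (rule set_eqI) (rule mem)
  moreover have "inj_on (Pair {1..k}) ?Z" by (rule inj_onI) simp
  ultimately have cardZ: "card (supp k ?\<Psi>) = card ?Z"
    by (simp only: card_image)
  have "9 - 1 \<le> k - 1" using k by simp
  then have "k * 8 \<le> k * (k - 1)" by (intro mult_left_mono) auto
  then have n: "4 * k \<le> n" unfolding n_def choose_two by linarith
  have "?Z \<noteq> {}" using ne unfolding cardZ by (metis card.empty not_one_le_zero)
  then obtain T\<^sub>1 where T1: "T\<^sub>1 \<subseteq> U" "?\<Psi> ({1..k}, T\<^sub>1) \<noteq> 0" by blast
  show "\<exists>H. simple_graph H \<and> card (verts H) = k \<and> alt_enum \<Phi> H \<noteq> 0 \<and>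
            real (card (edges H)) \<ge> 1/100 * real (k choose 2)"
  proof (rule ccontr)
    assume none: "\<not> ?thesis"
    have h: "alt_enum \<Phi> ({1..k}, S) = 0" if "S \<subseteq> U" "100 * card S \<ge> card U" for S
    proof (rule ccontr)
      assume "alt_enum \<Phi> ({1..k}, S) \<noteq> 0"
      moreover have "real (card S) \<ge> 1/100 * real (k choose 2)"
        using that(2) unfolding cardU n_def by linarith
      moreover have "simple_graph ({1..k}, S)" using simple that(1) by blast
      moreover have "card (verts ({1..k}, S)) = k" by simp
      ultimately show False using none by (metis snd_conv)
    qed
    have "4 * card {1..k} \<le> card U" using n cardU by simp
    from card_even_supp_ge[OF finite_atLeastAtMost U h this T1]
    have "2 ^ n \<le> (card ?Z)\<^sup>2" unfolding cardU .
    then have "real (2 ^ n) \<le> real ((card ?Z)\<^sup>2)" by (simp only: of_nat_le_iff)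
    also have "\<dots> \<le> ((sqrt 2 - \<epsilon>) ^ n)\<^sup>2"
      using power_mono[OF le, of 2] unfolding cardZ n_def by simp
    also have "\<dots> = ((sqrt 2 - \<epsilon>)\<^sup>2) ^ n" by (simp only: power_mult[symmetric] mult.commute)
    finally have "2 ^ n \<le> ((sqrt 2 - \<epsilon>)\<^sup>2) ^ n" by simp
    \<comment> \<open>Positivity of \<open>\<epsilon>\<close> makes this strict;
      \<open>\<epsilon> < 1\<close> keeps the base nonnegative, so that squaring preserves the
      order.\<close>
    moreover have "(sqrt 2 - \<epsilon>)\<^sup>2 < (sqrt 2)\<^sup>2"
    proof (rule power_strict_mono)
      have "1 < sqrt (2::real)" by simp
      then show "0 \<le> sqrt 2 - \<epsilon>" using assms by linarith
    qed (use assms in auto)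
    then have "((sqrt 2 - \<epsilon>)\<^sup>2) ^ n < 2 ^ n"
      using n k by (intro power_strict_mono) auto
    ultimately show False by simp
  qed
qed simp_all

end
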